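(* Let $\mu_1,\mu_2\in\mathbb{R}$, let $D:\mathbb{R}\to\mathbb{R}$ be an invertible additive function, and define $g_k:=D+\mu_k$ on $I$ for $k=1,2$. Let $F,f_1,f_2:I\to\mathbb{R}$ and $G:g_1(I)+g_2(I)\to\mathbb{R}$. Then $$F\Big(\frac{x+y}{2}\Big)+f_1(x)+f_2(y)=G(g_1(x)+g_2(y)),\qquad x,y\in I,$$ holds if and only if there exist an additive function $C:\mathbb{R}\to\mathbb{R}$ and $\lambda_1,\lambda_2\in\mathbb{R}$ such that $$f_k(x)=C(x)+\lambda_k\ (k=1,2)\qquad\text{and}\qquad G(u)=F\big(\tfrac12D^{-1}(u-\mu)\big)+C\big(D^{-1}(u-\mu)\big)+\Lambda$$ hold for all $x\in I$ and for all $u\in g_1(I)+g_2(I)$, where $\mu:=\mu_1+\mu_2$ and $\Lambda:=\lambda_1+\lambda_2$.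
   Context: $I\subseteq\mathbb{R}$ is a nonempty open interval. $X+Y=\{x+y\mid x\in X,\ y\in Y\}$. A function $C:\mathbb{R}\to\mathbb{R}$ is additive if $C(s+t)=C(s)+C(t)$ for all $s,t\in\mathbb{R}$; "invertible" means bijective from $\mathbb{R}$ to $\mathbb{R}$, with inverse $D^{-1}$. *)

theory Defs
  imports "HOL-Analysis.Analysis" "HOL-Library.Set_Algebras"
begin

end

theory Submission
  imports Defs
begin

text \<open>
  Since \<open>D\<close> is additive, \<open>g1 x + g2 y\<close> equals \<open>D (x + y) + (\<mu>1 + \<mu>2)\<close>, so the equation says exactly
  that \<open>f1 x + f2 y = H (x + y)\<close> on \<open>I\<close>, where \<open>H s = G (D s + (\<mu>1 + \<mu>2)) - F (s / 2)\<close>. This is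
  Pexider's equation restricted to an interval. Interchanging \<open>x\<close> and \<open>y\<close> shows that \<open>f1 - f2\<close> is
  constant; then, for a fixed \<open>a\<close> in \<open>I\<close>, the increment \<open>f1 (a + t) - f1 a\<close> is additive in \<open>t\<close> as
  long as all arguments stay in the translate \<open>I - a\<close>, which is an open interval around \<open>0\<close>
  (\<open>pexider_interval\<close>). Such a locally additive function \<open>g\<close> extends to the whole line by
  \<open>C x = n * g (x / n)\<close>, for any \<open>n\<close> so large that \<open>x / n\<close> lies in the neighbourhood
  (\<open>locally_additive_extends\<close>). Solving \<open>u = D (x + y) + (\<mu>1 + \<mu>2)\<close> for \<open>x + y\<close> turns the
  equation into the formula for \<open>G\<close>, and conversely.
\<close>

lemma locally_additive_mult_nat:
  fixes g :: "real \<Rightarrow> real"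
  assumes star: "\<And>c t. 0 \<le> c \<Longrightarrow> c \<le> 1 \<Longrightarrow> t \<in> J \<Longrightarrow> c * t \<in> J"
    and add: "\<And>s t. s \<in> J \<Longrightarrow> t \<in> J \<Longrightarrow> s + t \<in> J \<Longrightarrow> g (s + t) = g s + g t"
    and k: "real k * t \<in> J" and "j \<le> k"
  shows "g (real j * t) = real j * g t"
  using \<open>j \<le> k\<close>
proof (induction j)
  case 0
  have "0 \<in> J" using star[OF _ _ k, of 0] by simp
  then show ?case using add[of 0 0] by simp
next
  case (Suc j)
  have mem: "real i * t \<in> J" if "i \<le> k" for i
  proof -
    have "real i * t = real i / real k * (real k * t)" using that by (cases "k = 0") auto
    also have "\<dots> \<in> J" using that by (intro star k) (auto simp: divide_le_eq_1)
    finally show ?thesis .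
  qed
  have "g (real j * t + t) = g (real j * t) + g t"
    using mem[of j] mem[of 1] mem[of "Suc j"] Suc.prems
    by (intro add) (auto simp: algebra_simps)
  then show ?case using Suc by (simp add: algebra_simps)
qed

lemma locally_additive_extends:
  fixes g :: "real \<Rightarrow> real"
  assumes "open J" and "0 \<in> J"
    and star: "\<And>c t. 0 \<le> c \<Longrightarrow> c \<le> 1 \<Longrightarrow> t \<in> J \<Longrightarrow> c * t \<in> J"
    and add: "\<And>s t. s \<in> J \<Longrightarrow> t \<in> J \<Longrightarrow> s + t \<in> J \<Longrightarrow> g (s + t) = g s + g t"
  obtains C where "Modules.additive C" and "\<And>t. t \<in> J \<Longrightarrow> C t = g t"
proof -
  define P where "P x n \<longleftrightarrow> 0 < n \<and> x / real n \<in> J" for x :: real and n :: nat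
  define C where "C x = (let n = SOME n. P x n in real n * g (x / real n))" for x
  have ev: "eventually (P x) sequentially" for x
    unfolding P_def using topological_tendstoD[OF lim_const_over_n \<open>open J\<close> \<open>0 \<in> J\<close>]
    by (intro eventually_conj eventually_gt_at_top) auto
  have mult: "real n * (real m * g (x / (real n * real m))) = real n * g (x / real n)"
    if "P x n" "P x m" for x n m
    using locally_additive_mult_nat[OF star add, of m "x / (real n * real m)" m] that
    by (simp add: P_def)
  have C_eq: "C x = real n * g (x / real n)" if n: "P x n" for x n
  proof -
    define m where "m = (SOME n. P x n)"
    have m: "P x m" unfolding m_def using n by (rule someI)
    \<comment> \<open>both candidates equal \<open>n * m * g (x / (n * m))\<close>\<close>
    have "C x = real m * g (x / real m)" by (simp add: C_def m_def Let_def)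
    also have "\<dots> = real n * g (x / real n)"
      using mult[OF n m] mult[OF m n] by (simp add: mult.commute mult.left_commute)
    finally show ?thesis .
  qed
  have "Modules.additive C"
  proof (rule Modules.additive.intro)
    fix x y
    have "eventually (\<lambda>n. P x n \<and> P y n \<and> P (x + y) n) sequentially"
      by (intro eventually_conj ev)
    then obtain n where n: "P x n" "P y n" "P (x + y) n"
      by (auto dest: eventually_happens)
    then have "g (x / real n + y / real n) = g (x / real n) + g (y / real n)"
      by (intro add) (auto simp: P_def add_divide_distrib)
    then show "C (x + y) = C x + C y"
      using n by (simp add: C_eq add_divide_distrib algebra_simps)
  qed
  moreover have "C t = g t" if "t \<in> J" for t
    using C_eq[of t 1] that by (simp add: P_def)
  ultimately show thesis using that by blast
qed

lemma pexider_interval: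
  fixes f1 f2 H :: "real \<Rightarrow> real"
  assumes "is_interval I" and "open I" and "I \<noteq> {}"
    and eq: "\<And>x y. x \<in> I \<Longrightarrow> y \<in> I \<Longrightarrow> f1 x + f2 y = H (x + y)"
  obtains C l1 l2 where "Modules.additive C"
    and "\<And>x. x \<in> I \<Longrightarrow> f1 x = C x + l1" and "\<And>x. x \<in> I \<Longrightarrow> f2 x = C x + l2"
proof -
  obtain a where a: "a \<in> I" using \<open>I \<noteq> {}\<close> by blast
  define J where "J = {t. a + t \<in> I}"
  define g where "g t = f1 (a + t) - f1 a" for t
  have f2: "f2 x = f1 x + (f2 a - f1 a)" if "x \<in> I" for x
    using eq[OF that a] eq[OF a that] by (simp add: add.commute)
  have "open J"
    unfolding J_def using open_vimage[OF \<open>open I\<close>, of "\<lambda>t. a + t"]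
    by (simp add: vimage_def continuous_intros)
  moreover have "0 \<in> J" using a by (simp add: J_def)
  moreover have "c * t \<in> J" if "0 \<le> c" "c \<le> 1" "t \<in> J" for c t
  proof -
    have "convex I" using \<open>is_interval I\<close> by (rule is_interval_convex)
    then have "(1 - c) *\<^sub>R a + c *\<^sub>R (a + t) \<in> I"
      using that a by (intro convexD) (auto simp: J_def)
    then show ?thesis by (simp add: J_def algebra_simps)
  qed
  moreover have "g (s + t) = g s + g t" if "s \<in> J" "t \<in> J" "s + t \<in> J" for s t
  proof -
    have "f1 (a + s) + f2 (a + t) = f1 (a + (s + t)) + f2 a"
      using that a eq[of "a + s" "a + t"] eq[of "a + (s + t)" a] by (simp add: J_def add_ac)
    then show ?thesis using f2[of "a + t"] that by (simp add: g_def J_def)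
  qed
  ultimately obtain C where C: "Modules.additive C" "\<And>t. t \<in> J \<Longrightarrow> C t = g t"
    using locally_additive_extends by blast
  have f1: "f1 x = C x + (f1 a - C a)" if "x \<in> I" for x
    using C(2)[of "x - a"] Modules.additive.diff[OF C(1), of x a] that by (simp add: J_def g_def)
  show thesis
  proof (rule that[OF C(1) f1])
    show "f2 x = C x + (f1 a - C a + (f2 a - f1 a))" if "x \<in> I" for x
      using f1[OF that] f2[OF that] by simp
  qed
qed

theorem corollary10:
  fixes I :: "real set"
    and \<mu>1 \<mu>2 :: real
    and D g1 g2 F f1 f2 G :: "real \<Rightarrow> real"
  assumes "is_interval I" and "open I" and "I \<noteq> {}"
    and "Modules.additive D" and "bij D"
    and "\<And>x. x \<in> I \<Longrightarrow> g1 x = D x + \<mu>1"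
    and "\<And>x. x \<in> I \<Longrightarrow> g2 x = D x + \<mu>2"
  shows "(\<forall>x\<in>I. \<forall>y\<in>I. F ((x + y) / 2) + f1 x + f2 y = G (g1 x + g2 y)) \<longleftrightarrow>
    (\<exists>C :: real \<Rightarrow> real. \<exists>l1 l2 :: real. Modules.additive C \<and>
      (\<forall>x\<in>I. f1 x = C x + l1 \<and> f2 x = C x + l2) \<and>
      (\<forall>u \<in> g1 ` I + g2 ` I.
        G u = F (1 / 2 * inv D (u - (\<mu>1 + \<mu>2))) + C (inv D (u - (\<mu>1 + \<mu>2))) + (l1 + l2)))"
    (is "?eq \<longleftrightarrow> ?sol")
proof -
  have g: "g1 x + g2 y = D (x + y) + (\<mu>1 + \<mu>2)" if "x \<in> I" "y \<in> I" for x y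
    using assms(6,7) that Modules.additive.add[OF assms(4)] by simp
  have inv_D: "inv D (g1 x + g2 y - (\<mu>1 + \<mu>2)) = x + y" if "x \<in> I" "y \<in> I" for x y
    using g[OF that] bij_is_inj[OF \<open>bij D\<close>] by (simp add: inv_f_f)
  show ?thesis
  proof
    assume eq: ?eq
    have "f1 x + f2 y = G (D (x + y) + (\<mu>1 + \<mu>2)) - F ((x + y) / 2)"
      if "x \<in> I" "y \<in> I" for x y
      using bspec[OF bspec[OF eq that(1)] that(2)] g[OF that] by simp
    then obtain C l1 l2 where C: "Modules.additive C"
      and f: "\<And>x. x \<in> I \<Longrightarrow> f1 x = C x + l1" "\<And>x. x \<in> I \<Longrightarrow> f2 x = C x + l2"
      using pexider_interval[OF assms(1-3),
          of f1 f2 "\<lambda>s. G (D s + (\<mu>1 + \<mu>2)) - F (s / 2)"] by blast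
    have "G u = F (1 / 2 * inv D (u - (\<mu>1 + \<mu>2))) + C (inv D (u - (\<mu>1 + \<mu>2))) + (l1 + l2)"
      if u: "u \<in> g1 ` I + g2 ` I" for u
    proof -
      obtain x y where xy: "x \<in> I" "y \<in> I" "u = g1 x + g2 y"
        using u by (auto elim!: set_plus_elim)
      have "G u = F ((x + y) / 2) + f1 x + f2 y" using eq xy by simp
      then show ?thesis
        unfolding xy(3) inv_D[OF xy(1,2)]
        using f xy Modules.additive.add[OF C, of x y] by simp
    qed
    with C f show ?sol by blast
  next
    assume ?sol
    then obtain C l1 l2 where C: "Modules.additive C"
      and f: "\<And>x. x \<in> I \<Longrightarrow> f1 x = C x + l1 \<and> f2 x = C x + l2"
      and G: "\<And>u. u \<in> g1 ` I + g2 ` I \<Longrightarrow>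
        G u = F (1 / 2 * inv D (u - (\<mu>1 + \<mu>2))) + C (inv D (u - (\<mu>1 + \<mu>2))) + (l1 + l2)"
      by blast
    show ?eq
    proof (intro ballI)
      fix x y assume xy: "x \<in> I" "y \<in> I"
      then have "g1 x + g2 y \<in> g1 ` I + g2 ` I" by (intro set_plus_intro imageI)
      from G[OF this] show "F ((x + y) / 2) + f1 x + f2 y = G (g1 x + g2 y)"
        unfolding inv_D[OF xy] using f xy Modules.additive.add[OF C, of x y] by simp
    qed
  qed
qed

end
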